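(* Let $(X,d)$ be a metric space and $x_0\in X$. Let $I\subset\mathbb{R}_{\ge0}$ be a pure set containing $0$, and let $F:(I,\times)\to(X^X,\circ)$ be a monoid homomorphism such that $F(0)$ is the constant map with value $x_0$. Suppose that for each $x\in X$ there exist $\alpha_x,A_x>0$ such that $$\frac{\beta\, d(x,y)}{A_x}\le d(F(\beta)(x),F(\beta)(y))\le A_x\,\beta\, d(x,y)\quad\text{for all } y\in X \text{ and all } \beta\in I\cap(0,\alpha_x),$$ and that for each $x\in X$ the limit $\lim_{\alpha\to1,\ \alpha\in I}F(\alpha)(x)$ exists. Then the function $D:X\times X\to\mathbb{R}_{\ge0}$ defined by $$D(x,y)=\lim_{\alpha\to0^+}\sup\left\{\frac{d(F(\beta)(x),F(\beta)(y))}{\beta}\ :\ \beta\in I\cap(0,\alpha]\right\}$$ is a metric on $X$ that induces the same topology as $d$, and under $D$ the collection $\{F(\alpha)\}_{\alpha\in I}$ is a dilation family on $(X,D,x_0)$.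
   Context: $X^X$ is the monoid of all maps $X\to X$ under composition; monoid homomorphisms preserve the identity, so $F(1)=\mathrm{Id}_X$. Pure set: a subset $I\subset\mathbb{R}_{\ge0}$ closed under multiplication and containing $1$ such that at least one of the following holds: (1) $I\subset[1,\infty)$ and $\beta/\alpha\in I$ for all $\alpha<\beta$ in $I$; (2) $I\subset[0,1]$ and $\alpha/\beta\in I$ for all $\alpha<\beta$ in $I$; (3) $I$ is closed under division by nonzero elements. Dilation: a map $h:X\to X$ is a dilation of scale $\alpha\ge0$ with respect to a metric $D$ if $D(h(x),h(y))=\alpha D(x,y)$ for all $x,y\in X$. Dilation family: a family $\{T_\alpha\}_{\alpha\in I}$ of maps $X\to X$, with $I\subset\mathbb{R}_{\ge0}$ closed under multiplication, is a dilation family on $(X,D,x_0)$ if (1) each $T_\alpha$ is a dilation of scale $\alpha$ with respect to $D$; (2) $T_\alpha(x_0)=x_0$ for all $\alpha\in I$; (3) $T_\alpha\circ T_\beta=T_{\alpha\beta}$ for all $\alpha,\beta\in I$; (4) for every $x\in X$ the limit $\lim_{\alpha\to1}T_\alpha(x)$ exists.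
   Formalization: The case I = {0,1} is excluded: it is a pure set containing 0, but then I∩(0,α] is empty for α<1, so the supremum defining D is over the empty set and D is undefined (or identically 0, not a metric). *)

theory Defs
  imports "HOL-Analysis.Analysis" "HOL-Algebra.Group"
begin

definition pure_set :: "real set \<Rightarrow> bool" where
  "pure_set I \<longleftrightarrow>
     I \<subseteq> {0..} \<and> 1 \<in> I \<and> (\<forall>\<alpha>\<in>I. \<forall>\<beta>\<in>I. \<alpha> * \<beta> \<in> I) \<and>
     ((I \<subseteq> {1..} \<and> (\<forall>\<alpha>\<in>I. \<forall>\<beta>\<in>I. \<alpha> < \<beta> \<longrightarrow> \<beta> / \<alpha> \<in> I)) \<or>
      (I \<subseteq> {0..1} \<and> (\<forall>\<alpha>\<in>I. \<forall>\<beta>\<in>I. \<alpha> < \<beta> \<longrightarrow> \<alpha> / \<beta> \<in> I)) \<or>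
      (\<forall>\<alpha>\<in>I. \<forall>\<beta>\<in>I. \<beta> \<noteq> 0 \<longrightarrow> \<alpha> / \<beta> \<in> I))"

definition times_monoid :: "real set \<Rightarrow> real monoid" where
  "times_monoid I = \<lparr>carrier = I, monoid.mult = (*), one = 1\<rparr>"

text \<open>Self-maps of a carrier set are represented by extensional functions, so that equality of
  maps is equality of functions.\<close>

definition self_maps :: "'a set \<Rightarrow> ('a \<Rightarrow> 'a) monoid" where
  "self_maps X = \<lparr>carrier = X \<rightarrow>\<^sub>E X, monoid.mult = compose X, one = (\<lambda>x\<in>X. x)\<rparr>"

lemma monoid_times_monoid:
  assumes "pure_set I"
  shows "Group.monoid (times_monoid I)"
  using assms by unfold_locales (auto simp: times_monoid_def pure_set_def mult.assoc)

lemma monoid_self_maps: "Group.monoid (self_maps X)"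
proof
  fix f g h
  assume f: "f \<in> carrier (self_maps X)" and g: "g \<in> carrier (self_maps X)"
    and h: "h \<in> carrier (self_maps X)"
  show "f \<otimes>\<^bsub>self_maps X\<^esub> g \<in> carrier (self_maps X)"
    using f g by (auto simp: self_maps_def compose_def PiE_def)
  show "f \<otimes>\<^bsub>self_maps X\<^esub> g \<otimes>\<^bsub>self_maps X\<^esub> h = f \<otimes>\<^bsub>self_maps X\<^esub> (g \<otimes>\<^bsub>self_maps X\<^esub> h)"
    using h by (auto simp: self_maps_def compose_def PiE_def fun_eq_iff)
  show "\<one>\<^bsub>self_maps X\<^esub> \<otimes>\<^bsub>self_maps X\<^esub> f = f"
    using f by (auto simp: self_maps_def PiE_def intro!: Id_compose)
  show "f \<otimes>\<^bsub>self_maps X\<^esub> \<one>\<^bsub>self_maps X\<^esub> = f"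
    using f by (auto simp: self_maps_def PiE_def intro!: compose_Id)
next
  show "\<one>\<^bsub>self_maps X\<^esub> \<in> carrier (self_maps X)"
    by (auto simp: self_maps_def)
qed

text \<open>The library's \<open>hom\<close> does not require preservation of the identity.\<close>

definition monoid_hom :: "('a, 'm) monoid_scheme \<Rightarrow> ('b, 'n) monoid_scheme \<Rightarrow> ('a \<Rightarrow> 'b) set" where
  "monoid_hom G H = {h \<in> hom G H. h \<one>\<^bsub>G\<^esub> = \<one>\<^bsub>H\<^esub>}"

definition dilation :: "'a set \<Rightarrow> ('a \<Rightarrow> 'a \<Rightarrow> real) \<Rightarrow> real \<Rightarrow> ('a \<Rightarrow> 'a) \<Rightarrow> bool" where
  "dilation X D \<alpha> h \<longleftrightarrow> 0 \<le> \<alpha> \<and> h \<in> X \<rightarrow> X \<and> (\<forall>x\<in>X. \<forall>y\<in>X. D (h x) (h y) = \<alpha> * D x y)"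

text \<open>The limit of \<open>T \<alpha> x\<close> as \<open>\<alpha> \<rightarrow> 1\<close>
  is taken over \<open>\<alpha> \<in> I - {1}\<close>; its existence is a void condition when \<open>1\<close> is isolated in \<open>I\<close>.\<close>

definition has_limits_at_one ::
    "'a set \<Rightarrow> ('a \<Rightarrow> 'a \<Rightarrow> real) \<Rightarrow> real set \<Rightarrow> (real \<Rightarrow> 'a \<Rightarrow> 'a) \<Rightarrow> bool" where
  "has_limits_at_one X D I T \<longleftrightarrow>
     (\<forall>x\<in>X. \<exists>l. limitin (Metric_space.mtopology X D) (\<lambda>\<alpha>. T \<alpha> x) l (at 1 within I))"

definition dilation_family ::
    "'a set \<Rightarrow> ('a \<Rightarrow> 'a \<Rightarrow> real) \<Rightarrow> 'a \<Rightarrow> real set \<Rightarrow> (real \<Rightarrow> 'a \<Rightarrow> 'a) \<Rightarrow> bool" where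
  "dilation_family X D x0 I T \<longleftrightarrow>
     I \<subseteq> {0..} \<and> (\<forall>\<alpha>\<in>I. \<forall>\<beta>\<in>I. \<alpha> * \<beta> \<in> I) \<and>
     (\<forall>\<alpha>\<in>I. dilation X D \<alpha> (T \<alpha>)) \<and>
     (\<forall>\<alpha>\<in>I. T \<alpha> x0 = x0) \<and>
     (\<forall>\<alpha>\<in>I. \<forall>\<beta>\<in>I. \<forall>x\<in>X. T \<alpha> (T \<beta> x) = T (\<alpha> * \<beta>) x) \<and>
     has_limits_at_one X D I T"

text \<open>The supremum is taken in the extended reals because, for \<open>\<alpha>\<close> not small, the set of
  quotients may be unbounded.\<close>

definition quotient_sup ::
    "('a \<Rightarrow> 'a \<Rightarrow> real) \<Rightarrow> real set \<Rightarrow> (real \<Rightarrow> 'a \<Rightarrow> 'a) \<Rightarrow> 'a \<Rightarrow> 'a \<Rightarrow> real \<Rightarrow> ereal" where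
  "quotient_sup d I F x y \<alpha> = (SUP \<beta>\<in>I \<inter> {0<..\<alpha>}. ereal (d (F \<beta> x) (F \<beta> y) / \<beta>))"

definition limit_dist ::
    "('a \<Rightarrow> 'a \<Rightarrow> real) \<Rightarrow> real set \<Rightarrow> (real \<Rightarrow> 'a \<Rightarrow> 'a) \<Rightarrow> 'a \<Rightarrow> 'a \<Rightarrow> real" where
  "limit_dist d I F x y = real_of_ereal (Lim (at_right 0) (quotient_sup d I F x y))"

end

theory Submission
  imports Defs
begin

text \<open>The quotients \<open>d (F \<beta> x) (F \<beta> y) / \<beta>\<close> are trapped between \<open>d x y / A\<close> and \<open>A * d x y\<close> for
  small \<open>\<beta>\<close>, with \<open>A\<close> depending on \<open>x\<close> only. Their upper limit is therefore finite, positive off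
  the diagonal, and comparable to \<open>d\<close> around each point, which makes it a metric inducing the same
  topology. Purity says that multiplication by a nonzero \<open>\<gamma> \<in> I\<close> maps \<open>I \<inter> {0<..\<alpha>}\<close> onto
  \<open>I \<inter> {0<..\<gamma> * \<alpha>}\<close> for \<open>\<alpha> \<le> 1\<close>, so \<open>F \<gamma>\<close> scales the upper limit by exactly \<open>\<gamma>\<close>.\<close>

section \<open>Monotone limits and comparison of metric topologies\<close>

lemma mono_tendsto_at_right_INF:
  fixes f :: "real \<Rightarrow> 'b::{complete_linorder, linorder_topology}"
  assumes "mono_on {a<..} f"
  shows "(f \<longlongrightarrow> (INF x\<in>{a<..}. f x)) (at_right a)"
proof (rule order_tendstoI)
  fix l assume "l < (INF x\<in>{a<..}. f x)"
  then have "\<forall>x>a. l < f x"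
    by (metis INF_lower greaterThan_iff less_le_trans)
  then show "\<forall>\<^sub>F x in at_right a. l < f x"
    unfolding eventually_at_right_field by (intro exI[of _ "a + 1"]) simp
next
  fix u assume "(INF x\<in>{a<..}. f x) < u"
  then obtain b where b: "a < b" "f b < u"
    by (auto simp: INF_less_iff)
  have "f x < u" if "a < x" "x < b" for x
  proof -
    have "f x \<le> f b" using mono_onD[OF assms, of x b] that by simp
    then show ?thesis using b by simp
  qed
  then show "\<forall>\<^sub>F x in at_right a. f x < u"
    using b unfolding eventually_at_right_field by blast
qed

text \<open>Openness is tested one point at a time, so the constant \<open>A\<close> may vary with
  the centre \<open>x\<close>; no uniform bound is involved.\<close>

lemma Metric_space_mtopology_mono:
  assumes "Metric_space X d" "Metric_space X D"
    and "\<And>x. x \<in> X \<Longrightarrow> \<exists>A>0. \<forall>y\<in>X. d x y \<le> A * D x y"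
    and "openin (Metric_space.mtopology X d) U"
  shows "openin (Metric_space.mtopology X D) U"
proof -
  interpret d: Metric_space X d by fact
  interpret D: Metric_space X D by fact
  have "\<exists>r>0. D.mball x r \<subseteq> U" if "x \<in> U" for x
  proof -
    obtain r where r: "r > 0" "d.mball x r \<subseteq> U" and "x \<in> X"
      using assms(4) \<open>x \<in> U\<close> unfolding d.openin_mtopology by blast
    obtain A where A: "A > 0" "\<forall>y\<in>X. d x y \<le> A * D x y"
      using assms(3) \<open>x \<in> X\<close> by blast
    have "D.mball x (r / A) \<subseteq> d.mball x r"
    proof
      fix y assume y: "y \<in> D.mball x (r / A)"
      then have "A * D x y < r"
        using A by (auto simp: field_simps)
      then show "y \<in> d.mball x r"
        using A y by (auto intro: le_less_trans)
    qed
    with r A show ?thesis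
      by (intro exI[of _ "r / A"]) auto
  qed
  then show ?thesis
    using assms(4) by (auto simp: D.openin_mtopology d.openin_mtopology)
qed

lemma quotient_sup_mono: "\<alpha> \<le> \<alpha>' \<Longrightarrow> quotient_sup d I F x y \<alpha> \<le> quotient_sup d I F x y \<alpha>'"
  unfolding quotient_sup_def by (rule SUP_subset_mono) auto

text \<open>Shrinking the range of scales shrinks the supremum, so the limit defining
  \<open>limit_dist\<close> always exists in the extended reals. Whether it is finite is a separate
  question.\<close>

lemma quotient_sup_tendsto_INF:
  "(quotient_sup d I F x y \<longlongrightarrow> (INF \<alpha>\<in>{0<..}. quotient_sup d I F x y \<alpha>)) (at_right 0)"
  by (intro mono_tendsto_at_right_INF mono_onI quotient_sup_mono)

section \<open>Pure sets containing 0\<close>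

lemma pure_set_zero_divide:
  assumes "pure_set I" "0 \<in> I" "\<alpha> \<in> I" "\<beta> \<in> I" "\<alpha> \<le> \<beta>" "0 < \<beta>"
  shows "\<alpha> / \<beta> \<in> I"
proof (cases "\<alpha> = \<beta>")
  case True
  then show ?thesis using assms by (simp add: pure_set_def)
next
  case False
  then have "\<alpha> < \<beta>" using assms by simp
  moreover have "\<not> I \<subseteq> {1..}" using \<open>0 \<in> I\<close> by auto
  ultimately show ?thesis using assms unfolding pure_set_def by force
qed

text \<open>An element other than 0 and 1, or else its reciprocal, lies strictly between 0 and 1,
  and its powers tend to 0. For \<open>I = {0, 1}\<close> no scale lies below 1, the suprema for
  \<alpha> < 1 are over the empty set, and \<open>limit_dist\<close> would vanish
  identically.\<close>

lemma pure_set_zero_arbitrarily_small: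
  assumes "pure_set I" "0 \<in> I" "I \<noteq> {0, 1}" "0 < \<epsilon>"
  shows "\<exists>\<beta>\<in>I. 0 < \<beta> \<and> \<beta> \<le> \<epsilon>"
proof -
  have I: "I \<subseteq> {0..}" "1 \<in> I" "\<And>\<alpha> \<beta>. \<alpha> \<in> I \<Longrightarrow> \<beta> \<in> I \<Longrightarrow> \<alpha> * \<beta> \<in> I"
    using assms by (auto simp: pure_set_def)
  obtain c where c: "c \<in> I" "c \<noteq> 0" "c \<noteq> 1"
    using assms I by blast
  then have "c > 0" using I by force
  have "\<exists>b\<in>I. 0 < b \<and> b < 1"
  proof (cases "c < 1")
    case False
    then have "1 / c \<in> I"
      using pure_set_zero_divide[of I 1 c] assms c I by auto
    then show ?thesis using False c by (intro bexI[of _ "1 / c"]) auto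
  qed (use c \<open>c > 0\<close> in blast)
  then obtain b where b: "b \<in> I" "0 < b" "b < 1" by blast
  obtain n where "b ^ n < \<epsilon>"
    using b \<open>0 < \<epsilon>\<close> real_arch_pow_inv by blast
  moreover have "b ^ n \<in> I" using b I by (induction n) auto
  ultimately show ?thesis using b by (intro bexI[of _ "b ^ n"]) auto
qed

section \<open>The limit distance: bounds, metric axioms and topology\<close>

locale quasi_dilations = Metric_space X d for X :: "'a set" and d +
  fixes I :: "real set" and F :: "real \<Rightarrow> 'a \<Rightarrow> 'a"
  assumes nonneg_scales: "I \<subseteq> {0..}"
    and mult_scales: "\<alpha> \<in> I \<Longrightarrow> \<beta> \<in> I \<Longrightarrow> \<alpha> * \<beta> \<in> I"
    and divide_scales: "\<alpha> \<in> I \<Longrightarrow> \<beta> \<in> I \<Longrightarrow> \<alpha> \<le> \<beta> \<Longrightarrow> 0 < \<beta> \<Longrightarrow> \<alpha> / \<beta> \<in> I"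
    and small_scales: "0 < \<epsilon> \<Longrightarrow> \<exists>\<beta>\<in>I. 0 < \<beta> \<and> \<beta> \<le> \<epsilon>"
    and maps_into: "\<beta> \<in> I \<Longrightarrow> x \<in> X \<Longrightarrow> F \<beta> x \<in> X"
    and maps_compose: "\<alpha> \<in> I \<Longrightarrow> \<beta> \<in> I \<Longrightarrow> x \<in> X \<Longrightarrow> F \<alpha> (F \<beta> x) = F (\<alpha> * \<beta>) x"
    and quasi_dilation: "\<forall>x\<in>X. \<exists>\<alpha>x>0. \<exists>Ax>0. \<forall>y\<in>X. \<forall>\<beta>\<in>I \<inter> {0<..<\<alpha>x}.
      \<beta> * d x y / Ax \<le> d (F \<beta> x) (F \<beta> y) \<and> d (F \<beta> x) (F \<beta> y) \<le> Ax * \<beta> * d x y"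
begin

abbreviation "Q \<equiv> quotient_sup d I F"
abbreviation "D \<equiv> limit_dist d I F"

text \<open>The hypothesis on \<open>F\<close> divided by \<beta>. The constant is obtained before
  \<open>y\<close> is chosen, since the comparison of topologies needs one \<open>A\<close> for all
  \<open>y\<close>.\<close>

lemma quotient_sup_bounds:
  assumes "x \<in> X"
  obtains A where "A > 0"
    "\<And>y. y \<in> X \<Longrightarrow> \<forall>\<^sub>F \<alpha> in at_right 0. ereal (d x y / A) \<le> Q x y \<alpha> \<and> Q x y \<alpha> \<le> ereal (A * d x y)"
proof -
  obtain a A where a: "a > 0" and A: "A > 0" and
    bounds: "\<And>y \<beta>. y \<in> X \<Longrightarrow> \<beta> \<in> I \<Longrightarrow> 0 < \<beta> \<Longrightarrow> \<beta> < a \<Longrightarrow>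
      \<beta> * d x y / A \<le> d (F \<beta> x) (F \<beta> y) \<and> d (F \<beta> x) (F \<beta> y) \<le> A * \<beta> * d x y"
    using quasi_dilation assms by fastforce
  show ?thesis
  proof (rule that[OF A])
    fix y assume y: "y \<in> X"
    have q: "d x y / A \<le> d (F \<beta> x) (F \<beta> y) / \<beta>" "d (F \<beta> x) (F \<beta> y) / \<beta> \<le> A * d x y"
      if "\<beta> \<in> I" "0 < \<beta>" "\<beta> < a" for \<beta>
      using bounds[OF y that] that by (simp_all add: field_simps)
    have "ereal (d x y / A) \<le> Q x y \<alpha> \<and> Q x y \<alpha> \<le> ereal (A * d x y)" if \<alpha>: "0 < \<alpha>" "\<alpha> < a" for \<alpha>
    proof
      \<comment> \<open>The lower bound needs a scale in the range: an empty supremum is minus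
        infinity.\<close>
      obtain \<beta> where \<beta>: "\<beta> \<in> I" "0 < \<beta>" "\<beta> \<le> \<alpha>" using small_scales \<alpha> by blast
      show "ereal (d x y / A) \<le> Q x y \<alpha>"
        unfolding quotient_sup_def using \<beta> \<alpha> q by (intro SUP_upper2[of \<beta>]) auto
      show "Q x y \<alpha> \<le> ereal (A * d x y)"
        unfolding quotient_sup_def using \<alpha> q by (intro SUP_least) auto
    qed
    then show "\<forall>\<^sub>F \<alpha> in at_right 0. ereal (d x y / A) \<le> Q x y \<alpha> \<and> Q x y \<alpha> \<le> ereal (A * d x y)"
      using a unfolding eventually_at_right_field by blast
  qed
qed

lemma quotient_sup_tendsto:
  assumes "x \<in> X" "y \<in> X"
  shows "(Q x y \<longlongrightarrow> ereal (D x y)) (at_right 0)"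
proof -
  obtain A where A: "\<forall>\<^sub>F \<alpha> in at_right 0. ereal (d x y / A) \<le> Q x y \<alpha> \<and> Q x y \<alpha> \<le> ereal (A * d x y)"
    using quotient_sup_bounds assms by metis
  define L where "L = (INF \<alpha>\<in>{0<..}. Q x y \<alpha>)"
  have L: "(Q x y \<longlongrightarrow> L) (at_right 0)"
    unfolding L_def by (rule quotient_sup_tendsto_INF)
  have "ereal (d x y / A) \<le> L" "L \<le> ereal (A * d x y)"
    by (rule tendsto_lowerbound[OF L] tendsto_upperbound[OF L]; use A in \<open>auto elim: eventually_mono\<close>)+
  \<comment> \<open>Finiteness ensures that \<open>real_of_ereal\<close>, which sends both
    infinities to 0, loses nothing.\<close>
  then have "\<bar>L\<bar> \<noteq> \<infinity>" by auto
  moreover have "Lim (at_right 0) (Q x y) = L"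
    using L by (simp add: tendsto_Lim)
  ultimately show ?thesis
    using L by (simp add: limit_dist_def ereal_real)
qed

lemma limit_dist_eqI:
  assumes "x \<in> X" "y \<in> X" "(Q x y \<longlongrightarrow> ereal l) (at_right 0)"
  shows "D x y = l"
  using tendsto_unique[OF _ quotient_sup_tendsto[OF assms(1,2)] assms(3)] by simp

lemma limit_dist_bounds:
  assumes "x \<in> X"
  obtains A where "A > 0" "\<And>y. y \<in> X \<Longrightarrow> d x y \<le> A * D x y" "\<And>y. y \<in> X \<Longrightarrow> D x y \<le> A * d x y"
proof -
  obtain A where A: "A > 0" and ev: "\<And>y. y \<in> X \<Longrightarrow>
      \<forall>\<^sub>F \<alpha> in at_right 0. ereal (d x y / A) \<le> Q x y \<alpha> \<and> Q x y \<alpha> \<le> ereal (A * d x y)"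
    using quotient_sup_bounds assms by metis
  show ?thesis
  proof (rule that[OF A])
    fix y assume y: "y \<in> X"
    have "ereal (d x y / A) \<le> ereal (D x y)"
      by (rule tendsto_lowerbound[OF quotient_sup_tendsto[OF assms y]])
        (use ev[OF y] in \<open>auto elim: eventually_mono\<close>)
    then show "d x y \<le> A * D x y" using A by (simp add: field_simps)
    have "ereal (D x y) \<le> ereal (A * d x y)"
      by (rule tendsto_upperbound[OF quotient_sup_tendsto[OF assms y]])
        (use ev[OF y] in \<open>auto elim: eventually_mono\<close>)
    then show "D x y \<le> A * d x y" by simp
  qed
qed

text \<open>\<open>Metric_space\<close> demands nonnegativity off the carrier too. There the limit
  may be infinite, so the argument uses only its sign, not the bounds.\<close>

lemma limit_dist_nonneg: "0 \<le> D x y"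
proof -
  have "0 \<le> Q x y \<alpha>" if "\<alpha> > 0" for \<alpha>
  proof -
    obtain \<beta> where "\<beta> \<in> I" "0 < \<beta>" "\<beta> \<le> \<alpha>" using small_scales \<open>\<alpha> > 0\<close> by blast
    then show ?thesis
      unfolding quotient_sup_def by (intro SUP_upper2[of \<beta>]) auto
  qed
  then have "0 \<le> (INF \<alpha>\<in>{0<..}. Q x y \<alpha>)"
    by (intro INF_greatest) auto
  then show ?thesis
    using tendsto_Lim[OF _ quotient_sup_tendsto_INF[of d I F x y]]
    by (simp add: limit_dist_def real_of_ereal_pos)
qed

lemma quotient_sup_triangle:
  assumes "x \<in> X" "y \<in> X" "z \<in> X"
  shows "Q x z \<alpha> \<le> Q x y \<alpha> + Q y z \<alpha>"
  unfolding quotient_sup_def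
proof (rule SUP_least)
  fix \<beta> assume \<beta>: "\<beta> \<in> I \<inter> {0<..\<alpha>}"
  have "d (F \<beta> x) (F \<beta> z) \<le> d (F \<beta> x) (F \<beta> y) + d (F \<beta> y) (F \<beta> z)"
    using assms \<beta> by (intro triangle maps_into) auto
  then have "ereal (d (F \<beta> x) (F \<beta> z) / \<beta>) \<le>
      ereal (d (F \<beta> x) (F \<beta> y) / \<beta>) + ereal (d (F \<beta> y) (F \<beta> z) / \<beta>)"
    using \<beta> by (simp add: divide_simps)
  also have "\<dots> \<le> (SUP \<beta>\<in>I \<inter> {0<..\<alpha>}. ereal (d (F \<beta> x) (F \<beta> y) / \<beta>)) +
      (SUP \<beta>\<in>I \<inter> {0<..\<alpha>}. ereal (d (F \<beta> y) (F \<beta> z) / \<beta>))"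
    using \<beta> by (intro add_mono SUP_upper)
  finally show "ereal (d (F \<beta> x) (F \<beta> z) / \<beta>) \<le> \<dots>" .
qed

lemma Metric_space_limit_dist: "Metric_space X D"
proof
  fix x y
  show "0 \<le> D x y" by (rule limit_dist_nonneg)
  show "D x y = D y x"
    unfolding limit_dist_def quotient_sup_def by (simp add: commute)
next
  fix x y assume xy: "x \<in> X" "y \<in> X"
  \<comment> \<open>The first bound makes \<open>D\<close> separate points; the second makes it
    vanish on the diagonal.\<close>
  obtain A where "d x y \<le> A * D x y" "D x y \<le> A * d x y"
    using limit_dist_bounds xy by metis
  then show "D x y = 0 \<longleftrightarrow> x = y"
    using xy limit_dist_nonneg[of x y] nonneg[of x y] zero[of x y] by (cases "x = y") force+
next
  fix x y z assume xyz: "x \<in> X" "y \<in> X" "z \<in> X"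
  \<comment> \<open>Both limits are finite, which avoids the discontinuity of extended addition at
    opposite infinities.\<close>
  have "((\<lambda>\<alpha>. Q x y \<alpha> + Q y z \<alpha>) \<longlongrightarrow> ereal (D x y) + ereal (D y z)) (at_right 0)"
    using xyz by (intro tendsto_add_ereal quotient_sup_tendsto) auto
  then have "ereal (D x z) \<le> ereal (D x y) + ereal (D y z)"
    using xyz by (intro tendsto_le[OF _ _ quotient_sup_tendsto[of x z]])
      (auto simp: quotient_sup_triangle)
  then show "D x z \<le> D x y + D y z" by simp
qed

lemma mtopology_limit_dist: "Metric_space.mtopology X D = mtopology"
proof -
  have le: "\<exists>A>0. \<forall>y\<in>X. d x y \<le> A * D x y" "\<exists>A>0. \<forall>y\<in>X. D x y \<le> A * d x y" if "x \<in> X" for x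
    by (rule limit_dist_bounds[OF that], blast)+
  show ?thesis
    unfolding topology_eq
  proof (intro allI iffI)
    fix U
    show "openin mtopology U" if "openin (Metric_space.mtopology X D) U"
      using Metric_space_limit_dist Metric_space_axioms le(2) that
      by (rule Metric_space_mtopology_mono)
    show "openin (Metric_space.mtopology X D) U" if "openin mtopology U"
      using Metric_space_axioms Metric_space_limit_dist le(1) that
      by (rule Metric_space_mtopology_mono)
  qed
qed

section \<open>Exact scaling of the limit distance\<close>

lemma quotient_sup_scale:
  assumes "x \<in> X" "y \<in> X" "\<gamma> \<in> I" "0 < \<gamma>" "0 < \<alpha>" "\<alpha> \<le> 1"
  shows "Q (F \<gamma> x) (F \<gamma> y) \<alpha> = ereal \<gamma> * Q x y (\<gamma> * \<alpha>)"
proof -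
  have eq: "I \<inter> {0<..\<gamma> * \<alpha>} = (*) \<gamma> ` (I \<inter> {0<..\<alpha>})"
  proof (intro equalityI subsetI)
    fix \<beta> assume \<beta>: "\<beta> \<in> I \<inter> {0<..\<gamma> * \<alpha>}"
    \<comment> \<open>Here \<alpha> \<le> 1 enters: \<open>divide_scales\<close> provides only
      quotients that are at most 1.\<close>
    then have "\<beta> \<le> \<gamma>" using assms by (auto intro: order_trans simp: mult_left_le)
    then have "\<beta> / \<gamma> \<in> I" using \<beta> assms divide_scales by auto
    then show "\<beta> \<in> (*) \<gamma> ` (I \<inter> {0<..\<alpha>})"
      using \<beta> assms by (intro image_eqI[of _ _ "\<beta> / \<gamma>"]) (auto simp: field_simps)
  qed (use assms mult_scales in auto)
  have "Q (F \<gamma> x) (F \<gamma> y) \<alpha> =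
      (SUP \<beta>\<in>I \<inter> {0<..\<alpha>}. ereal \<gamma> * ereal (d (F (\<gamma> * \<beta>) x) (F (\<gamma> * \<beta>) y) / (\<gamma> * \<beta>)))"
    unfolding quotient_sup_def using assms
    by (intro SUP_cong) (auto simp: maps_compose mult.commute)
  also have "\<dots> = ereal \<gamma> * (SUP \<beta>\<in>I \<inter> {0<..\<alpha>}. ereal (d (F (\<gamma> * \<beta>) x) (F (\<gamma> * \<beta>) y) / (\<gamma> * \<beta>)))"
    using small_scales[OF \<open>0 < \<alpha>\<close>] assms by (intro Sup_ereal_mult_left'[symmetric]) auto
  also have "\<dots> = ereal \<gamma> * Q x y (\<gamma> * \<alpha>)"
    unfolding quotient_sup_def eq by (simp add: image_image)
  finally show ?thesis .
qed

lemma limit_dist_scale: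
  assumes "x \<in> X" "y \<in> X" "\<gamma> \<in> I" "0 < \<gamma>"
  shows "D (F \<gamma> x) (F \<gamma> y) = \<gamma> * D x y"
proof (rule limit_dist_eqI)
  have "filterlim (\<lambda>\<alpha>. \<gamma> * \<alpha>) (at_right 0) (at_right 0)"
    using assms by (intro filterlim_times_pos[OF filterlim_ident]) auto
  then have "((\<lambda>\<alpha>. Q x y (\<gamma> * \<alpha>)) \<longlongrightarrow> ereal (D x y)) (at_right 0)"
    by (rule filterlim_compose[OF quotient_sup_tendsto[OF assms(1,2)]])
  then have "((\<lambda>\<alpha>. ereal \<gamma> * Q x y (\<gamma> * \<alpha>)) \<longlongrightarrow> ereal \<gamma> * ereal (D x y)) (at_right 0)"
    by (intro tendsto_cmult_ereal) auto
  \<comment> \<open>The restriction \<alpha> \<le> 1 in \<open>quotient_sup_scale\<close> is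
    harmless in the limit at 0.\<close>
  moreover have "\<forall>\<^sub>F \<alpha> in at_right 0. 0 < \<alpha> \<and> \<alpha> \<le> (1::real)"
    unfolding eventually_at_right_field by (intro exI[of _ 1]) simp
  then have "\<forall>\<^sub>F \<alpha> in at_right 0. ereal \<gamma> * Q x y (\<gamma> * \<alpha>) = Q (F \<gamma> x) (F \<gamma> y) \<alpha>"
    by eventually_elim (use quotient_sup_scale assms in auto)
  ultimately show "(Q (F \<gamma> x) (F \<gamma> y) \<longlongrightarrow> ereal (\<gamma> * D x y)) (at_right 0)"
    using Lim_transform_eventually by fastforce
qed (use assms maps_into in auto)

end

theorem proposition2p10:
  fixes X :: "'a set" and d :: "'a \<Rightarrow> 'a \<Rightarrow> real" and x0 :: 'a
    and I :: "real set" and F :: "real \<Rightarrow> 'a \<Rightarrow> 'a"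
  assumes "Metric_space X d" and "x0 \<in> X"
    and "pure_set I" and "0 \<in> I"
    and "I \<noteq> {0, 1}"
    and "F \<in> monoid_hom (times_monoid I) (self_maps X)"
    and "F 0 = (\<lambda>x\<in>X. x0)"
    and "\<forall>x\<in>X. \<exists>\<alpha>x>0. \<exists>Ax>0. \<forall>y\<in>X. \<forall>\<beta>\<in>I \<inter> {0<..<\<alpha>x}.
           \<beta> * d x y / Ax \<le> d (F \<beta> x) (F \<beta> y) \<and> d (F \<beta> x) (F \<beta> y) \<le> Ax * \<beta> * d x y"
    and "has_limits_at_one X d I F"
  shows "(\<forall>x\<in>X. \<forall>y\<in>X. 0 \<le> limit_dist d I F x y \<and>
            (quotient_sup d I F x y \<longlongrightarrow> ereal (limit_dist d I F x y)) (at_right 0)) \<and>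
         Metric_space X (limit_dist d I F) \<and>
         Metric_space.mtopology X (limit_dist d I F) = Metric_space.mtopology X d \<and>
         dilation_family X (limit_dist d I F) x0 I F"
proof -
  have maps: "F \<beta> \<in> X \<rightarrow>\<^sub>E X" if "\<beta> \<in> I" for \<beta>
  proof -
    have "F \<in> I \<rightarrow> (X \<rightarrow>\<^sub>E X)"
      using assms(6) by (simp add: monoid_hom_def hom_def times_monoid_def self_maps_def)
    with that show ?thesis by (rule funcset_mem[rotated])
  qed
  have comp: "F \<alpha> (F \<beta> x) = F (\<alpha> * \<beta>) x" if "\<alpha> \<in> I" "\<beta> \<in> I" "x \<in> X" for \<alpha> \<beta> x
  proof -
    have "F (\<alpha> * \<beta>) = compose X (F \<alpha>) (F \<beta>)"
      using assms(6) that by (simp add: monoid_hom_def hom_def times_monoid_def self_maps_def)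
    with that show ?thesis by (simp add: compose_def)
  qed
  interpret Metric_space X d by fact
  interpret quasi_dilations X d I F
  proof unfold_locales
    show "I \<subseteq> {0..}" and "\<And>\<alpha> \<beta>. \<alpha> \<in> I \<Longrightarrow> \<beta> \<in> I \<Longrightarrow> \<alpha> * \<beta> \<in> I"
      using \<open>pure_set I\<close> by (auto simp: pure_set_def)
    show "\<And>\<alpha> \<beta>. \<alpha> \<in> I \<Longrightarrow> \<beta> \<in> I \<Longrightarrow> \<alpha> \<le> \<beta> \<Longrightarrow> 0 < \<beta> \<Longrightarrow> \<alpha> / \<beta> \<in> I"
      by (rule pure_set_zero_divide[OF assms(3,4)])
    show "\<And>\<epsilon>. 0 < \<epsilon> \<Longrightarrow> \<exists>\<beta>\<in>I. 0 < \<beta> \<and> \<beta> \<le> \<epsilon>"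
      by (rule pure_set_zero_arbitrarily_small[OF assms(3-5)])
    show "\<And>\<beta> x. \<beta> \<in> I \<Longrightarrow> x \<in> X \<Longrightarrow> F \<beta> x \<in> X"
      using maps by blast
  qed (fact comp assms(8))+
  \<comment> \<open>Since \<open>x0\<close> is a value of \<open>F 0\<close>, applying
    \<open>F \<alpha>\<close> to it gives a value of \<open>F (\<alpha> * 0) = F 0\<close>, again
    \<open>x0\<close>.\<close>
  have fixed: "F \<alpha> x0 = x0" if "\<alpha> \<in> I" for \<alpha>
    using comp[OF that \<open>0 \<in> I\<close> \<open>x0 \<in> X\<close>] assms by simp
  have "D (F \<alpha> x) (F \<alpha> y) = \<alpha> * D x y" if "\<alpha> \<in> I" "x \<in> X" "y \<in> X" for \<alpha> x y
  proof (cases "\<alpha> = 0")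
    \<comment> \<open>The substitution argument requires a positive factor; at scale 0 both sides
      vanish because \<open>F 0\<close> is constant.\<close>
    case True
    then show ?thesis
      using assms(2,7) that Metric_space.zero[OF Metric_space_limit_dist, of x0 x0] by simp
  next
    case False
    then have "0 < \<alpha>" using nonneg_scales that by force
    then show ?thesis using limit_dist_scale that by blast
  qed
  then have "dilation X D \<alpha> (F \<alpha>)" if "\<alpha> \<in> I" for \<alpha>
    using that nonneg_scales maps_into by (auto simp: dilation_def)
  \<comment> \<open>Convergence at 1 depends on the metric only through its topology.\<close>
  moreover have "has_limits_at_one X D I F"
    using assms(9) by (simp add: has_limits_at_one_def mtopology_limit_dist)
  ultimately have "dilation_family X D x0 I F"
    using nonneg_scales mult_scales fixed comp by (simp add: dilation_family_def)
  then show ?thesis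
    using limit_dist_nonneg quotient_sup_tendsto Metric_space_limit_dist mtopology_limit_dist
    by blast
qed

end
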